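(* Let $I=[a,b]\subset\mathbb R$ be an interval and let $G:I\to J\subset\mathbb R$ be in $C^\infty(I)$ with $|G'(x)|>0$ for all $x\in I$. Let $C>0$ and $M\in\mathbb N$. Assume further that for some fixed $x_0\in I$ we have $\cos(\lambda G(x_0))\neq0$ for all $\lambda\in[0,C)$, and that for a fixed $\tau$ with $0<|\tau|\le\pi/C$ we have $\tau k+G(x_0)\in G(I)$ for $k=-2M+1,\dots,2M-1$. Then the parameters $c_j\in\mathbb C\setminus\{0\}$ and (pairwise distinct) $\lambda_j\in[0,C)$, $j=1,\dots,M$, of $$f(x)=\sum_{j=1}^M c_j\cos(\lambda_jG(x)),\qquad x\in I,$$ can be uniquely reconstructed (i.e., the set of pairs $(\lambda_j,c_j)$ is uniquely determined among all functions of this form) from the samples $f(G^{-1}(\tau k+G(x_0)))$, $k=-2M+1,\dots,2M-1$.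
   Context: $G(I):=\{G(x):x\in I\}$ is the image of $G$ and $G^{-1}:G(I)\to I$ is the inverse of the strictly monotone function $G$. The function $G$ and the numbers $M$, $C$, $\tau$, $x_0$ are known. *)

theory Defs
  imports "HOL-Analysis.Analysis"
begin

text \<open>Derivative relative to a set \<open>S\<close>, so one-sided at the end points when \<open>S\<close> is a
  compact interval. Its values outside of \<open>S\<close> carry no meaning and are never used.\<close>

definition deriv_on :: "real set \<Rightarrow> (real \<Rightarrow> real) \<Rightarrow> real \<Rightarrow> real" where
  "deriv_on S g x = vector_derivative g (at x within S)"

definition smooth_on :: "real set \<Rightarrow> (real \<Rightarrow> real) \<Rightarrow> bool" where
  "smooth_on S g \<longleftrightarrow> (\<forall>n. ((deriv_on S ^^ n) g) differentiable_on S)"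

text \<open>The function \<open>f\<close> is, on \<open>S\<close>, the sum of \<open>M\<close> terms \<open>c j * cos (lam j * G x)\<close> with nonzero
  complex coefficients and pairwise distinct frequencies in \<open>[0, C)\<close>. Only the values
  \<open>lam j\<close> and \<open>c j\<close> with \<open>j \<in> {1..M}\<close> matter.\<close>

definition cosine_sum_on ::
  "real set \<Rightarrow> (real \<Rightarrow> real) \<Rightarrow> real \<Rightarrow> nat \<Rightarrow> (nat \<Rightarrow> real) \<Rightarrow> (nat \<Rightarrow> complex) \<Rightarrow> (real \<Rightarrow> complex) \<Rightarrow> bool"
  where
  "cosine_sum_on S G C M lam c f \<longleftrightarrow>
     (\<forall>j\<in>{1..M}. c j \<noteq> 0) \<and>
     (\<forall>j\<in>{1..M}. lam j \<in> {0..<C}) \<and>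
     inj_on lam {1..M} \<and>
     (\<forall>x\<in>S. f x = (\<Sum>j=1..M. c j * complex_of_real (cos (lam j * G x))))"

end

theory Submission imports Defs begin

text \<open>
  Write \<open>g = G x\<^sub>0\<close>. Adding the samples at \<open>k\<close> and \<open>-k\<close> turns a term \<open>c cos (l (\<tau> k + g))\<close>
  into \<open>2 c cos (l g) cos (k l \<tau>)\<close>. The difference of two functions with the same samples is a
  cosine sum over at most \<open>2M\<close> distinct frequencies, namely those of either function, and so
  it satisfies \<open>\<Sum>l. w l cos (l g) cos (k l \<tau>) = 0\<close> for all \<open>\<bar>k\<bar> < 2M\<close>.

  Since \<open>l \<bar>\<tau>\<bar>\<close> lies in \<open>[0, \<pi>)\<close>, where cosine is injective, the nodes \<open>cos (l \<tau>)\<close> are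
  pairwise distinct. As \<open>cos (k \<theta>)\<close> is a polynomial of degree \<open>\<bar>k\<bar>\<close> in \<open>cos \<theta>\<close>, the relations
  annihilate all polynomials of degree below \<open>2M\<close>, among them the polynomial that vanishes at
  all nodes but one. So every \<open>w l cos (l g)\<close> is zero
  (lemma \<open>cosine_moments_determine_weights\<close>), and \<open>w l = 0\<close> because \<open>cos (l g) \<noteq> 0\<close>.

  To compare two families of parameters that may share some frequencies and not others, each
  family is encoded by the function \<open>amplitude\<close> from frequencies to coefficients, which is zero
  off the frequencies of the family and determines the set of parameter pairs.\<close>

text \<open>Multiplication by \<open>cos \<theta> - y\<close> raises the order \<open>k\<close> of the moments involved by one, because
  \<open>2 cos \<theta> cos (k \<theta>) = cos ((k + 1) \<theta>) + cos ((k - 1) \<theta>)\<close>. Taking products of such linear factors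
  directly replaces any use of Chebyshev polynomials; \<open>k\<close> ranges over the integers so that
  \<open>k - 1\<close> needs no special case at \<open>k = 0\<close>.\<close>

lemma cosine_moments_times_linear_factors:
  fixes \<theta> :: "'a \<Rightarrow> real" and u :: "'a \<Rightarrow> complex" and y :: "'b \<Rightarrow> real"
  assumes moments: "\<And>k::int. \<bar>k\<bar> < int N \<Longrightarrow> (\<Sum>l\<in>U. u l * complex_of_real (cos (k * \<theta> l))) = 0"
    and "finite B" and "int (card B) + \<bar>k\<bar> < int N"
  shows "(\<Sum>l\<in>U. u l * complex_of_real ((\<Prod>m\<in>B. cos (\<theta> l) - y m) * cos (k * \<theta> l))) = 0"
  using assms(2,3)
proof (induction B arbitrary: k rule: finite_induct)
  case empty
  then show ?case using moments[of k] by simp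
next
  case (insert b B)
  define P where "P = (\<lambda>l. \<Prod>m\<in>B. cos (\<theta> l) - y m)"
  define T where "T = (\<lambda>(k::int) l. complex_of_real (P l * cos (k * \<theta> l)))"
  have IH: "(\<Sum>l\<in>U. u l * T (k + 1) l) = 0" "(\<Sum>l\<in>U. u l * T (k - 1) l) = 0"
      "(\<Sum>l\<in>U. u l * T k l) = 0"
    unfolding T_def P_def by (rule insert.IH, use insert.hyps insert.prems in simp)+
  have step: "cos t * cos (k * t) = (cos ((k + 1) * t) + cos ((k - 1) * t)) / 2" for t :: real
    by (simp add: ring_distribs cos_add cos_diff)
  have pointwise: "complex_of_real ((\<Prod>m\<in>insert b B. cos (\<theta> l) - y m) * cos (k * \<theta> l))
      = (T (k + 1) l + T (k - 1) l) / 2 - complex_of_real (y b) * T k l" for l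
  proof -
    have "(\<Prod>m\<in>insert b B. cos (\<theta> l) - y m) * cos (k * \<theta> l)
        = P l * (cos (\<theta> l) * cos (k * \<theta> l)) - y b * (P l * cos (k * \<theta> l))"
      using insert.hyps by (simp add: P_def left_diff_distrib right_diff_distrib mult_ac)
    also have "\<dots> = (P l * cos ((k + 1) * \<theta> l) + P l * cos ((k - 1) * \<theta> l)) / 2
        - y b * (P l * cos (k * \<theta> l))"
      unfolding step by (simp only: distrib_left times_divide_eq_right)
    finally show ?thesis by (simp add: T_def)
  qed
  have "(\<Sum>l\<in>U. u l * complex_of_real ((\<Prod>m\<in>insert b B. cos (\<theta> l) - y m) * cos (k * \<theta> l)))
      = (\<Sum>l\<in>U. (u l * T (k + 1) l + u l * T (k - 1) l) / 2 - complex_of_real (y b) * (u l * T k l))"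
    unfolding pointwise by (simp add: right_diff_distrib distrib_left mult_ac)
  also have "\<dots> = 0"
    by (simp add: sum_subtractf sum_divide_distrib[symmetric] sum.distrib
        sum_distrib_left[symmetric] IH)
  finally show ?case .
qed

lemma cosine_moments_determine_weights:
  fixes \<theta> :: "'a \<Rightarrow> real" and u :: "'a \<Rightarrow> complex"
  assumes "finite U" and inj: "inj_on (\<lambda>l. cos (\<theta> l)) U"
    and moments: "\<And>k::int. \<bar>k\<bar> < int (card U) \<Longrightarrow> (\<Sum>l\<in>U. u l * complex_of_real (cos (k * \<theta> l))) = 0"
    and l: "l \<in> U"
  shows "u l = 0"
proof -
  \<comment> \<open>The node polynomial without the factor of \<open>l\<close> isolates the weight at \<open>l\<close>; its degree
    \<open>card U - 1\<close> is the highest one that the moments reach.\<close>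
  define p where "p = (\<lambda>m. \<Prod>n\<in>U - {l}. cos (\<theta> m) - cos (\<theta> n))"
  have card: "card (U - {l}) < card U"
    using \<open>finite U\<close> l by (rule card_Diff1_less)
  have "0 = (\<Sum>m\<in>U. u m * complex_of_real (p m))"
    using cosine_moments_times_linear_factors[OF moments,
        where B = "U - {l}" and k = 0 and y = "\<lambda>n. cos (\<theta> n)"] \<open>finite U\<close> card
    by (simp add: p_def)
  also have "\<dots> = (\<Sum>m\<in>U. if m = l then u l * complex_of_real (p l) else 0)"
    using \<open>finite U\<close> by (intro sum.cong) (auto simp: p_def)
  also have "\<dots> = u l * complex_of_real (p l)"
    using \<open>finite U\<close> l by simp
  finally have "u l * complex_of_real (p l) = 0" by simp
  moreover have "p l \<noteq> 0"
    using \<open>finite U\<close> inj l by (auto simp: p_def inj_on_def)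
  ultimately show ?thesis by simp
qed

text \<open>Summing over the fibre of \<open>lam\<close> avoids choosing an index for each frequency, and the empty
  sum gives the value zero off the frequencies of the family.\<close>

definition amplitude :: "'i set \<Rightarrow> ('i \<Rightarrow> real) \<Rightarrow> ('i \<Rightarrow> complex) \<Rightarrow> real \<Rightarrow> complex" where
  "amplitude A lam c l = (\<Sum>j | j \<in> A \<and> lam j = l. c j)"

lemma sum_amplitude:
  assumes "finite A" "finite U" "lam ` A \<subseteq> U"
  shows "(\<Sum>l\<in>U. amplitude A lam c l * h l) = (\<Sum>j\<in>A. c j * h (lam j))"
proof -
  have "(\<Sum>l\<in>U. amplitude A lam c l * h l) = (\<Sum>l\<in>U. \<Sum>j | j \<in> A \<and> lam j = l. c j * h (lam j))"
    by (simp add: amplitude_def sum_distrib_right)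
  also have "\<dots> = (\<Sum>j\<in>A. c j * h (lam j))"
    using assms by (rule sum.group)
  finally show ?thesis .
qed

lemma amplitude_outside: "l \<notin> lam ` A \<Longrightarrow> amplitude A lam c l = 0"
  by (auto simp: amplitude_def intro: sum.neutral)

lemma amplitude_at:
  assumes "inj_on lam A" "j \<in> A"
  shows "amplitude A lam c (lam j) = c j"
proof -
  have "{i. i \<in> A \<and> lam i = lam j} = {j}"
    using assms by (auto simp: inj_on_def)
  then show ?thesis by (simp add: amplitude_def)
qed

lemma pairs_eq_graph_amplitude:
  assumes "inj_on lam A" "\<forall>j\<in>A. c j \<noteq> 0"
  shows "{(lam j, c j) | j. j \<in> A} = {(l, amplitude A lam c l) | l. amplitude A lam c l \<noteq> 0}"
    (is "?P = ?Q")
proof (intro equalityI subsetI)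
  fix x assume "x \<in> ?P"
  then obtain j where "j \<in> A" "x = (lam j, c j)" by blast
  then show "x \<in> ?Q" using assms amplitude_at[of lam A j c] by force
next
  fix x assume "x \<in> ?Q"
  then obtain l where l: "x = (l, amplitude A lam c l)" "amplitude A lam c l \<noteq> 0" by blast
  have "l \<in> lam ` A" using l(2) amplitude_outside[of l lam A c] by argo
  then obtain j where "j \<in> A" "l = lam j" by blast
  then show "x \<in> ?P" using assms(1) l(1) amplitude_at[of lam A j c] by auto
qed

theorem theorem4p6:
  fixes a b C \<tau> x\<^sub>0 :: real and M :: nat and I J :: "real set" and G :: "real \<Rightarrow> real"
    and f g :: "real \<Rightarrow> complex" and lam mu :: "nat \<Rightarrow> real" and c d :: "nat \<Rightarrow> complex"
  assumes "a < b" and "I = {a..b}"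
    and "G \<in> I \<rightarrow> J"
    and "smooth_on I G"
    and "\<forall>x\<in>I. \<bar>deriv_on I G x\<bar> > 0"
    and "C > 0"
    and "x\<^sub>0 \<in> I"
    and "\<forall>l\<in>{0..<C}. cos (l * G x\<^sub>0) \<noteq> 0"
    and "0 < \<bar>\<tau>\<bar>" and "\<bar>\<tau>\<bar> \<le> pi / C"
    and "\<forall>k\<in>{- 2 * int M + 1 .. 2 * int M - 1}. \<tau> * real_of_int k + G x\<^sub>0 \<in> G ` I"
    and "cosine_sum_on I G C M lam c f"
    and "cosine_sum_on I G C M mu d g"
    and "\<forall>k\<in>{- 2 * int M + 1 .. 2 * int M - 1}.
           f (inv_into I G (\<tau> * real_of_int k + G x\<^sub>0)) = g (inv_into I G (\<tau> * real_of_int k + G x\<^sub>0))"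
  shows "{(lam j, c j) | j. j \<in> {1..M}} = {(mu j, d j) | j. j \<in> {1..M}}"
proof -
  define A where "A = {1..M}"
  define U where "U = lam ` A \<union> mu ` A"
  define w where "w = (\<lambda>l. amplitude A lam c l - amplitude A mu d l)"
  define y where "y = G x\<^sub>0"
  have fin: "finite A" "finite U" by (simp_all add: A_def U_def)
  have cardU: "card U \<le> 2 * M"
    using card_Un_le[of "lam ` A" "mu ` A"] card_image_le[OF fin(1), of lam]
      card_image_le[OF fin(1), of mu] by (simp add: U_def A_def)
  have f: "\<forall>j\<in>A. c j \<noteq> 0" "inj_on lam A" "\<forall>j\<in>A. lam j \<in> {0..<C}"
      "\<And>x. x \<in> I \<Longrightarrow> f x = (\<Sum>j\<in>A. c j * complex_of_real (cos (lam j * G x)))"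
    and g: "\<forall>j\<in>A. d j \<noteq> 0" "inj_on mu A" "\<forall>j\<in>A. mu j \<in> {0..<C}"
      "\<And>x. x \<in> I \<Longrightarrow> g x = (\<Sum>j\<in>A. d j * complex_of_real (cos (mu j * G x)))"
    using assms(12,13) by (simp_all add: cosine_sum_on_def A_def)
  have U: "U \<subseteq> {0..<C}" using f(3) g(3) by (auto simp: U_def)

  have sample: "(\<Sum>l\<in>U. w l * complex_of_real (cos (l * (\<tau> * real_of_int k + y)))) = 0"
    if "k \<in> {- 2 * int M + 1 .. 2 * int M - 1}" for k
  proof -
    define t where "t = \<tau> * real_of_int k + y"
    define x where "x = inv_into I G t"
    have "t \<in> G ` I" using assms(11) that by (simp add: t_def y_def)
    then have x: "x \<in> I" "G x = t"
      by (simp_all add: x_def inv_into_into f_inv_into_f)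
    have fg: "f x = g x" using assms(14) that by (simp add: x_def t_def y_def)
    have "(\<Sum>l\<in>U. w l * complex_of_real (cos (l * t))) = f x - g x"
      using sum_amplitude[OF fin, of lam c "\<lambda>l. complex_of_real (cos (l * t))"]
        sum_amplitude[OF fin, of mu d "\<lambda>l. complex_of_real (cos (l * t))"]
      by (simp add: f(4) g(4) x w_def U_def left_diff_distrib sum_subtractf)
    then show ?thesis using fg by (simp add: t_def)
  qed

  have moments: "(\<Sum>l\<in>U. w l * complex_of_real (cos (l * y)) * complex_of_real (cos (k * (l * \<tau>)))) = 0"
    if "\<bar>k\<bar> < int (card U)" for k :: int
  proof -
    have k: "k \<in> {- 2 * int M + 1 .. 2 * int M - 1}" "- k \<in> {- 2 * int M + 1 .. 2 * int M - 1}"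
      using that cardU by auto
    have split: "cos (l * (\<tau> * real_of_int k + y)) + cos (l * (\<tau> * real_of_int (- k) + y))
        = 2 * (cos (l * y) * cos (k * (l * \<tau>)))" for l
    proof -
      have "l * (\<tau> * real_of_int k + y) = l * y + k * (l * \<tau>)"
        "l * (\<tau> * real_of_int (- k) + y) = l * y - k * (l * \<tau>)"
        by (simp_all add: algebra_simps)
      then show ?thesis by (simp only: cos_add cos_diff)
    qed
    have "0 = (\<Sum>l\<in>U. w l * complex_of_real (cos (l * (\<tau> * real_of_int k + y))
              + cos (l * (\<tau> * real_of_int (- k) + y))))"
      by (simp only: of_real_add distrib_left[of "w l" for l] sum.distrib sample[OF k(1)]
          sample[OF k(2)] add_0)
    also have "\<dots> = 2 * (\<Sum>l\<in>U. w l * complex_of_real (cos (l * y)) * complex_of_real (cos (k * (l * \<tau>))))"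
      unfolding split by (simp add: sum_distrib_left mult_ac)
    finally show ?thesis by simp
  qed

  have inj: "inj_on (\<lambda>l. cos (l * \<tau>)) U"
  proof (rule inj_onI)
    fix l m assume lm: "l \<in> U" "m \<in> U" "cos (l * \<tau>) = cos (m * \<tau>)"
    have range: "0 \<le> r * \<bar>\<tau>\<bar> \<and> r * \<bar>\<tau>\<bar> \<le> pi" "cos (r * \<bar>\<tau>\<bar>) = cos (r * \<tau>)" if "r \<in> U" for r
    proof -
      have r: "0 \<le> r" "r \<le> C" using U that by auto
      then have "r * \<bar>\<tau>\<bar> \<le> C * (pi / C)"
        using assms(6,10) by (intro mult_mono) auto
      then show "0 \<le> r * \<bar>\<tau>\<bar> \<and> r * \<bar>\<tau>\<bar> \<le> pi" using r assms(6) by simp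
      show "cos (r * \<bar>\<tau>\<bar>) = cos (r * \<tau>)" by (simp add: abs_if)
    qed
    have "cos (l * \<bar>\<tau>\<bar>) = cos (m * \<bar>\<tau>\<bar>)"
      using lm(3) by (simp only: range(2)[OF lm(1)] range(2)[OF lm(2)])
    then have "l * \<bar>\<tau>\<bar> = m * \<bar>\<tau>\<bar>"
      using range(1)[OF lm(1)] range(1)[OF lm(2)] cos_inj_pi by blast
    then show "l = m" using assms(9) by simp
  qed

  have "w l = 0" for l
  proof (cases "l \<in> U")
    case True
    have "w l * complex_of_real (cos (l * y)) = 0"
      using cosine_moments_determine_weights[OF fin(2) inj,
          of "\<lambda>l. w l * complex_of_real (cos (l * y))"] moments True by blast
    moreover have "cos (l * y) \<noteq> 0" using assms(8) True U by (auto simp: y_def)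
    ultimately show ?thesis by simp
  next
    case False
    then show ?thesis by (simp add: w_def U_def amplitude_outside)
  qed
  then have "amplitude A lam c = amplitude A mu d" by (auto simp: w_def)
  then show ?thesis
    using pairs_eq_graph_amplitude[OF f(2,1)] pairs_eq_graph_amplitude[OF g(2,1)]
    by (simp add: A_def)
qed

end
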